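(* Let $p\in\Bbbk[t]$ be a polynomial with $\deg p\geq 1$, let $C\in\Bbbk$, let $\lambda\in R_{u+C}$, and let $X\subseteq R_{u+C}\setminus\{\lambda\}$ be a submultiset. Then the exponential $\mathcal{S}_u$-module $\mathcal{E}(p,C,\lambda,X)$ is free of rank $\deg p$ as a module over $\Bbbk[h]$. Furthermore, if there is no $\mu\in R_{u+C}\setminus\{\lambda\}$ such that $\mu-\lambda\in\mathbb{Z}_{\geq 1}$, then the $\mathcal{S}_u$-module $\mathcal{E}(p,C,\lambda,R_{u+C}\setminus\{\lambda\})$ is simple.
   Context: $\Bbbk$ is an algebraically closed field of characteristic zero. Fix a nonzero polynomial $g(h)\in\Bbbk[h]$ and a polynomial $u(h)\in\Bbbk[h]$ with $g(h)=u(h-1)-u(h)$ (such $u$ exists, is unique up to its constant term, and $\deg u=\deg g+1\geq 1$). The Smith algebra $\mathcal{S}_u$ is the unital associative $\Bbbk$-algebra generated by $x,y,h$ with defining relations $[h,y]=y$, $[h,x]=-x$, $[y,x]=g(h)$. For a nonzero polynomial $f(h)$, $R_f$ denotes the multiset of its roots in $\Bbbk$ (with multiplicity); $R_{u+C}$ is the root multiset of $u(h)+C$. For a finite multiset $X$ of elements of $\Bbbk$, $\mathrm{poly}_X=\prod_{\alpha\in X}(h-\alpha)$ (with multiplicity; $\mathrm{poly}_\emptyset=1$). Differences of multisets are taken with multiplicity: $X\setminus\{\lambda\}$ lowers the multiplicity of $\lambda$ by one. Let $A_1=\Bbbk[t,\partial]$, $\partial=\frac{d}{dt}$, be the first Weyl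 algebra. Given $C\in\Bbbk$, $\lambda\in R_{u+C}$ and a submultiset $X\subseteq R_{u+C}\setminus\{\lambda\}$, set $Q_X(h)=\mathrm{poly}_X$ and $P_X(h)=\dfrac{u(h-1)+C}{Q_X(h-1)(h-(\lambda+1))}\in\Bbbk[h]$. There is an algebra homomorphism $\varphi_{C,\lambda,X}:\mathcal{S}_u\to A_1$ with $x\mapsto\partial Q_X(\theta-1)$, $y\mapsto tP_X(\theta+1)$, $h\mapsto\theta$, where $\theta=t\partial+\lambda+1$. For $p\in\Bbbk[t]$, $\Bbbk[t]e^p$ denotes the $A_1$-module consisting of expressions $qe^p$ with $q\in\Bbbk[t]$, where $t$ acts by multiplication and $\partial(qe^p)=(q'+qp')e^p$. The exponential module $\mathcal{E}(p,C,\lambda,X)$ is the $\mathcal{S}_u$-module obtained from $\Bbbk[t]e^p$ by pulling back along $\varphi_{C,\lambda,X}$. *)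

theory Defs
  imports
    "HOL-Library.Poly_Mapping"
    "HOL-Computational_Algebra.Polynomial"
    "HOL-Algebra.QuotRing"
begin

section \<open>Algebras given by generators and relations\<close>

text \<open>The free monoid, written additively: then the type of finitely supported functions on it,
  with its convolution product from \<^theory>\<open>HOL-Library.Poly_Mapping\<close>, is the free unital
  associative algebra.\<close>

datatype 'g word = Word (letters: "'g list")

instantiation word :: (type) monoid_add
begin

definition zero_word :: "'a word" where "0 = Word []"

definition plus_word :: "'a word \<Rightarrow> 'a word \<Rightarrow> 'a word" where
  "v + w = Word (letters v @ letters w)"

instance
  by standard (auto simp: zero_word_def plus_word_def)

end

type_synonym ('g, 'k) free_algebra = "'g word \<Rightarrow>\<^sub>0 'k"

definition cst :: "'k::zero \<Rightarrow> ('g, 'k) free_algebra" where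
  "cst c = Poly_Mapping.single 0 c"

definition gen :: "'g \<Rightarrow> ('g, 'k::zero_neq_one) free_algebra" where
  "gen g = Poly_Mapping.single (Word [g]) 1"

definition peval :: "'k::ring_1 poly \<Rightarrow> ('g, 'k) free_algebra \<Rightarrow> ('g, 'k) free_algebra" where
  "peval f a = (\<Sum>i\<le>degree f. cst (coeff f i) * a ^ i)"

text \<open>The algebra homomorphism between free algebras with given images of the generators.\<close>

definition subst ::
  "('g \<Rightarrow> ('h, 'k::ring_1) free_algebra) \<Rightarrow> ('g, 'k) free_algebra \<Rightarrow> ('h, 'k) free_algebra" where
  "subst f a = (\<Sum>w\<in>Poly_Mapping.keys a.
     cst (Poly_Mapping.lookup a w) * prod_list (map f (letters w)))"

text \<open>The action of the free algebra on the vector space of polynomials for which the generator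
  \<open>g\<close> acts by the operator \<open>\<rho> g\<close>.\<close>

definition free_act ::
  "('g \<Rightarrow> 'k poly \<Rightarrow> 'k poly) \<Rightarrow> ('g, 'k::comm_ring_1) free_algebra \<Rightarrow> 'k poly \<Rightarrow> 'k poly" where
  "free_act \<rho> a q = (\<Sum>w\<in>Poly_Mapping.keys a.
     smult (Poly_Mapping.lookup a w) (foldr \<rho> (letters w) q))"

definition ring_of_type :: "'a::ring_1 ring" where
  "ring_of_type = \<lparr>carrier = UNIV, monoid.mult = (*), one = 1, ring.zero = 0, add = (+)\<rparr>"

text \<open>\<open>Idl\<close> is the two-sided ideal generated by a set.\<close>

definition presented_algebra ::
  "('g, 'k::ring_1) free_algebra set \<Rightarrow> ('g, 'k) free_algebra set ring" where
  "presented_algebra R = ring_of_type Quot (Idl\<^bsub>ring_of_type\<^esub> R)"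

definition coset_of ::
  "('g, 'k::ring_1) free_algebra set \<Rightarrow> ('g, 'k) free_algebra \<Rightarrow> ('g, 'k) free_algebra set" where
  "coset_of R a = (Idl\<^bsub>ring_of_type\<^esub> R) +>\<^bsub>ring_of_type\<^esub> a"


section \<open>Modules\<close>

text \<open>Left modules over a not necessarily commutative ring; the underlying abelian group is a
  whole type.\<close>

locale left_module = ring R for R (structure) +
  fixes act :: "'r \<Rightarrow> 'm::ab_group_add \<Rightarrow> 'm"
  assumes act_add_right: "r \<in> carrier R \<Longrightarrow> act r (v + w) = act r v + act r w"
    and act_add_left: "\<lbrakk>r \<in> carrier R; s \<in> carrier R\<rbrakk> \<Longrightarrow> act (r \<oplus> s) v = act r v + act s v"
    and act_mult: "\<lbrakk>r \<in> carrier R; s \<in> carrier R\<rbrakk> \<Longrightarrow> act (r \<otimes> s) v = act r (act s v)"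
    and act_one: "act \<one> v = v"

definition left_submodule ::
  "('r, 'b) ring_scheme \<Rightarrow> ('r \<Rightarrow> 'm::ab_group_add \<Rightarrow> 'm) \<Rightarrow> 'm set \<Rightarrow> bool" where
  "left_submodule R act N \<longleftrightarrow>
     0 \<in> N \<and> (\<forall>v\<in>N. \<forall>w\<in>N. v + w \<in> N) \<and> (\<forall>r\<in>carrier R. \<forall>v\<in>N. act r v \<in> N)"

definition simple_left_module ::
  "('r, 'b) ring_scheme \<Rightarrow> ('r \<Rightarrow> 'm::ab_group_add \<Rightarrow> 'm) \<Rightarrow> bool" where
  "simple_left_module R act \<longleftrightarrow>
     left_module R act \<and> (\<exists>v::'m. v \<noteq> 0) \<and>
     (\<forall>N. left_submodule R act N \<longrightarrow> N = {0} \<or> N = UNIV)"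

definition free_module_of_rank ::
  "('r::comm_ring_1 \<Rightarrow> 'm::ab_group_add \<Rightarrow> 'm) \<Rightarrow> nat \<Rightarrow> bool" where
  "free_module_of_rank scale n \<longleftrightarrow>
     Modules.module scale \<and>
     (\<exists>B. finite B \<and> card B = n \<and> \<not> module.dependent scale B \<and> module.span scale B = UNIV)"


section \<open>The Smith algebra\<close>

text \<open>\<open>f(h + c)\<close>\<close>

definition translate :: "'k::comm_ring_1 \<Rightarrow> 'k poly \<Rightarrow> 'k poly" where
  "translate c f = f \<circ>\<^sub>p [:c, 1:]"

datatype smith_gen = X_gen | Y_gen | H_gen

definition smith_relations :: "'k::field poly \<Rightarrow> (smith_gen, 'k) free_algebra set" where
  "smith_relations u =
     (let x = gen X_gen; y = gen Y_gen; h = gen H_gen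
      in {(h * y - y * h) - y,
          (h * x - x * h) - (- x),
          (y * x - x * y) - peval (translate (-1) u - u) h})"

definition smith_algebra :: "'k::field poly \<Rightarrow> (smith_gen, 'k) free_algebra set ring" where
  "smith_algebra u = presented_algebra (smith_relations u)"

definition smith_class ::
  "'k::field poly \<Rightarrow> (smith_gen, 'k) free_algebra \<Rightarrow> (smith_gen, 'k) free_algebra set" where
  "smith_class u = coset_of (smith_relations u)"


section \<open>The Weyl algebra and its modules \<open>\<bbbk>[t]e\<^sup>p\<close>\<close>

datatype weyl_gen = T_gen | D_gen

text \<open>The relation is \<open>[\<partial>, t] = 1\<close>; on \<open>\<bbbk>[t]\<close> (the case \<open>p = 0\<close> of \<open>exp_op\<close> below)
  \<open>\<partial>\<close> is \<open>d/dt\<close>.\<close>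

definition weyl_relations :: "(weyl_gen, 'k::field) free_algebra set" where
  "weyl_relations = {gen D_gen * gen T_gen - gen T_gen * gen D_gen - 1}"

definition weyl_algebra :: "(weyl_gen, 'k::field) free_algebra set ring" where
  "weyl_algebra = presented_algebra weyl_relations"

definition weyl_class ::
  "(weyl_gen, 'k::field) free_algebra \<Rightarrow> (weyl_gen, 'k) free_algebra set" where
  "weyl_class = coset_of weyl_relations"

text \<open>The polynomial \<open>q\<close> stands for the expression \<open>q e\<^sup>p\<close>.\<close>

fun exp_op :: "'k::field poly \<Rightarrow> weyl_gen \<Rightarrow> 'k poly \<Rightarrow> 'k poly" where
  "exp_op p T_gen q = [:0, 1:] * q"
| "exp_op p D_gen q = pderiv q + q * pderiv p"

text \<open>Elements of the quotient algebras are cosets; a map on the quotient is described by its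
  value on any representative.\<close>

definition weyl_act ::
  "'k::field poly \<Rightarrow> (weyl_gen, 'k) free_algebra set \<Rightarrow> 'k poly \<Rightarrow> 'k poly" where
  "weyl_act p w q = the_elem ((\<lambda>a. free_act (exp_op p) a q) ` w)"


section \<open>Exponential modules\<close>

definition poly_of_roots :: "'k::field multiset \<Rightarrow> 'k poly" where
  "poly_of_roots X = (\<Prod>\<alpha>\<in>#X. [:-\<alpha>, 1:])"

definition P_poly :: "'k::field poly \<Rightarrow> 'k \<Rightarrow> 'k \<Rightarrow> 'k multiset \<Rightarrow> 'k poly" where
  "P_poly u C lam X =
     (translate (-1) u + [:C:]) div (translate (-1) (poly_of_roots X) * [:-(lam + 1), 1:])"

definition theta :: "'k::field \<Rightarrow> (weyl_gen, 'k) free_algebra" where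
  "theta lam = gen T_gen * gen D_gen + cst (lam + 1)"

text \<open>The images of the generators under \<open>phi\<close> below, given by representatives in the free
  algebra on \<open>t\<close> and \<open>\<partial>\<close>.\<close>

fun phi_gen ::
  "'k::field poly \<Rightarrow> 'k \<Rightarrow> 'k \<Rightarrow> 'k multiset \<Rightarrow> smith_gen \<Rightarrow> (weyl_gen, 'k) free_algebra" where
  "phi_gen u C lam X X_gen = gen D_gen * peval (poly_of_roots X) (theta lam - 1)"
| "phi_gen u C lam X Y_gen = gen T_gen * peval (P_poly u C lam X) (theta lam + 1)"
| "phi_gen u C lam X H_gen = theta lam"

definition phi ::
  "'k::field poly \<Rightarrow> 'k \<Rightarrow> 'k \<Rightarrow> 'k multiset \<Rightarrow>
   (smith_gen, 'k) free_algebra set \<Rightarrow> (weyl_gen, 'k) free_algebra set" where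
  "phi u C lam X s = the_elem ((\<lambda>a. weyl_class (subst (phi_gen u C lam X) a)) ` s)"

definition exp_act ::
  "'k::field poly \<Rightarrow> 'k poly \<Rightarrow> 'k \<Rightarrow> 'k \<Rightarrow> 'k multiset \<Rightarrow>
   (smith_gen, 'k) free_algebra set \<Rightarrow> 'k poly \<Rightarrow> 'k poly" where
  "exp_act u p C lam X s = weyl_act p (phi u C lam X s)"

text \<open>Restriction of scalars to the subalgebra \<open>\<bbbk>[h]\<close> of the Smith algebra.\<close>

definition exp_h_scale ::
  "'k::field poly \<Rightarrow> 'k poly \<Rightarrow> 'k \<Rightarrow> 'k \<Rightarrow> 'k multiset \<Rightarrow> 'k poly \<Rightarrow> 'k poly \<Rightarrow> 'k poly" where
  "exp_h_scale u p C lam X f = exp_act u p C lam X (smith_class u (peval f (gen H_gen)))"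


section \<open>Well-definedness\<close>

text \<open>All choices of representatives made above are immaterial: \<open>phi\<close> is a ring homomorphism with
  the prescribed values (\<open>phi_class\<close>, \<open>phi_hom\<close>), and \<open>weyl_act\<close> and \<open>exp_act\<close> are module
  structures (\<open>left_module_weyl_act\<close>, \<open>left_module_exp_act\<close>).\<close>

lemma ring_of_type_simps [simp]:
  "carrier ring_of_type = UNIV" "mult ring_of_type = (*)" "monoid.one ring_of_type = 1"
  "ring.zero ring_of_type = 0" "add ring_of_type = (+)"
  by (simp_all add: ring_of_type_def)

lemma ring_ring_of_type: "ring (ring_of_type :: 'a::ring_1 ring)"
proof -
  have "\<exists>y. y + x = 0 \<and> x + y = 0" for x :: 'a
    by (rule exI[of _ "-x"]) simp
  then show ?thesis
    by unfold_locales (auto simp: algebra_simps Units_def)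
qed

lemma free_algebra_sum:
  "a = (\<Sum>w\<in>Poly_Mapping.keys a. Poly_Mapping.single w (Poly_Mapping.lookup a w))"
  by (rule poly_mapping_eqI) (simp add: lookup_sum lookup_single when_def in_keys_iff sum.delta)

lemma free_algebra_induct [case_names single add]:
  assumes "\<And>w c. P (Poly_Mapping.single w c)" "\<And>a b. P a \<Longrightarrow> P b \<Longrightarrow> P (a + b)"
  shows "P (a :: ('g, 'k::ring_1) free_algebra)"
proof -
  have "P (\<Sum>w\<in>W. Poly_Mapping.single w (Poly_Mapping.lookup a w))" if "finite W" for W
    using that
  proof induction
    case empty
    then show ?case using assms(1)[of 0 0] by simp
  next
    case (insert w W)
    then show ?case using assms by simp
  qed
  from this[of "Poly_Mapping.keys a"] show ?thesis
    by (simp only: finite_keys free_algebra_sum[symmetric])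
qed

lemma keys_sum_superset:
  assumes "finite W" "Poly_Mapping.keys a \<subseteq> W" "\<And>w. F w 0 = 0"
  shows "(\<Sum>w\<in>Poly_Mapping.keys a. F w (Poly_Mapping.lookup a w)) =
         (\<Sum>w\<in>W. F w (Poly_Mapping.lookup a w))"
  using assms by (intro sum.mono_neutral_left) (auto simp: in_keys_iff)

lemma keys_sum_add:
  assumes "\<And>w. F w 0 = 0" "\<And>w c d. F w (c + d) = F w c + F w d"
  shows "(\<Sum>w\<in>Poly_Mapping.keys (a + b). F w (Poly_Mapping.lookup (a + b) w)) =
         (\<Sum>w\<in>Poly_Mapping.keys a. F w (Poly_Mapping.lookup a w)) +
         (\<Sum>w\<in>Poly_Mapping.keys b. F w (Poly_Mapping.lookup b w))"
proof -
  define W where "W = Poly_Mapping.keys a \<union> Poly_Mapping.keys b"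
  have W: "finite W" "Poly_Mapping.keys a \<subseteq> W" "Poly_Mapping.keys b \<subseteq> W"
    "Poly_Mapping.keys (a + b) \<subseteq> W"
    by (auto simp: W_def dest: subsetD[OF keys_add])
  show ?thesis
    using W(2-) by (simp only: keys_sum_superset[where F = F, OF W(1) _ assms(1)])
      (simp add: lookup_add assms(2) sum.distrib)
qed

lemma cst_0 [simp]: "cst 0 = 0" and cst_1 [simp]: "cst 1 = 1"
  by (simp_all add: cst_def)
lemma cst_add: "cst (c + d) = cst c + cst d" by (simp add: cst_def single_add)
lemma cst_minus: "cst (- c) = - cst (c::'k::ring_1)" by (simp add: cst_def single_uminus)
lemma cst_mult: "cst (c * d) = cst c * cst (d::'k::ring_1)" by (simp add: cst_def mult_single)
lemma cst_comm: "cst c * a = a * cst (c::'k::comm_ring_1)"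
  by (induction a rule: free_algebra_induct) (simp_all add: cst_def mult_single algebra_simps)

lemma subst_add: "subst f (a + b) = subst f a + subst f b"
  unfolding subst_def by (rule keys_sum_add) (simp_all add: cst_add algebra_simps)

lemma subst_single: "subst f (Poly_Mapping.single w c) = cst c * prod_list (map f (letters w))"
  by (cases "c = 0") (simp_all add: subst_def)

lemma subst_mult: "subst f (a * b) = subst f a * subst f (b :: ('g, 'k::comm_ring_1) free_algebra)"
proof (induction a rule: free_algebra_induct)
  case (single w c)
  show ?case
  proof (induction b rule: free_algebra_induct)
    case (single v d)
    let ?p = "prod_list (map f (letters w))" and ?q = "prod_list (map f (letters v))"
    have "cst c * cst d * (?p * ?q) = cst c * (cst d * ?p) * ?q" by (simp only: mult.assoc)
    also have "cst d * ?p = ?p * cst d" by (rule cst_comm)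
    finally show ?case
      by (simp add: mult_single subst_single plus_word_def cst_mult mult.assoc)
  qed (simp add: subst_add algebra_simps)
qed (simp add: subst_add algebra_simps)

lemma subst_cst [simp]: "subst f (cst c) = cst c"
  by (simp add: cst_def subst_single zero_word_def)
lemma subst_1 [simp]: "subst f 1 = 1" using subst_cst[of f 1] by simp
lemma subst_gen [simp]: "subst f (gen g) = f g" by (simp add: gen_def subst_single)
lemma subst_0 [simp]: "subst f 0 = 0" using subst_cst[of f 0] by simp
lemma subst_minus [simp]: "subst f (- a) = - subst f a"
  by (metis add.right_inverse add_eq_0_iff subst_0 subst_add)
lemma subst_diff: "subst f (a - b) = subst f a - subst f b"
  using subst_add[of f a "-b"] by simp
lemma subst_power: "subst f (a ^ n) = subst f (a :: ('g, 'k::comm_ring_1) free_algebra) ^ n"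
  by (induction n) (simp_all add: subst_mult)
lemma subst_sum: "subst f (sum F A) = (\<Sum>i\<in>A. subst f (F i))"
  by (induction A rule: infinite_finite_induct) (simp_all add: subst_add)
lemma subst_peval: "subst f (peval q a) = peval q (subst f (a :: ('g, 'k::comm_ring_1) free_algebra))"
  by (simp add: peval_def subst_sum subst_mult subst_power)

lemma free_act_add_left: "free_act \<rho> (a + b) q = free_act \<rho> a q + free_act \<rho> b q"
  unfolding free_act_def by (rule keys_sum_add) (simp_all add: smult_add_left)

lemma free_act_single: "free_act \<rho> (Poly_Mapping.single w c) q = smult c (foldr \<rho> (letters w) q)"
  by (cases "c = 0") (simp_all add: free_act_def)

lemma exp_op_linear:
  "exp_op p g (q + r) = exp_op p g q + exp_op p g r" "exp_op p g (smult c q) = smult c (exp_op p g q)"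
  by (cases g; simp add: algebra_simps pderiv_add pderiv_smult smult_add_right)+

lemma exp_foldr_linear:
  "foldr (exp_op p) w (q + r) = foldr (exp_op p) w q + foldr (exp_op p) w r"
  "foldr (exp_op p) w (smult c q) = smult c (foldr (exp_op p) w q)"
  by (induction w) (simp_all add: exp_op_linear)

lemma free_act_linear:
  "free_act (exp_op p) a (q + r) = free_act (exp_op p) a q + free_act (exp_op p) a r"
  "free_act (exp_op p) a (smult c q) = smult c (free_act (exp_op p) a q)"
  by (induction a rule: free_algebra_induct)
     (simp_all add: free_act_single free_act_add_left exp_foldr_linear smult_add_right algebra_simps)

lemma free_act_mult: "free_act (exp_op p) (a * b) q = free_act (exp_op p) a (free_act (exp_op p) b q)"
proof (induction a rule: free_algebra_induct)
  case (single w c)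
  show ?case
    by (induction b rule: free_algebra_induct)
       (simp_all add: mult_single free_act_single free_act_add_left plus_word_def
         exp_foldr_linear smult_add_right algebra_simps)
qed (simp add: free_act_add_left algebra_simps)

lemma free_act_cst [simp]: "free_act \<rho> (cst c) q = smult c q"
  unfolding cst_def free_act_single by (simp add: zero_word_def)

lemma free_act_1 [simp]: "free_act \<rho> 1 q = q"
  using free_act_cst[of \<rho> 1 q] by simp

lemma free_act_0 [simp]: "free_act \<rho> 0 q = 0"
  by (simp add: free_act_def)

lemma free_act_gen [simp]: "free_act \<rho> (gen g) q = \<rho> g q"
  unfolding gen_def free_act_single by simp

lemma free_act_diff: "free_act (exp_op p) (a - b) q = free_act (exp_op p) a q - free_act (exp_op p) b q"
  using free_act_add_left[of "exp_op p" "a - b" b q] by (simp add: algebra_simps)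

lemma free_act_relation: "r \<in> weyl_relations \<Longrightarrow> free_act (exp_op p) r q = 0"
  unfolding weyl_relations_def
  by (simp only: singleton_iff)
     (simp add: free_act_diff free_act_add_left free_act_mult pderiv_mult pderiv_pCons pderiv_add algebra_simps)

abbreviation rel_ideal :: "('g, 'k::ring_1) free_algebra set \<Rightarrow> ('g, 'k) free_algebra set" where
  "rel_ideal R \<equiv> Idl\<^bsub>ring_of_type\<^esub> R"

lemma ideal_rel_ideal: "ideal (rel_ideal R) ring_of_type"
  using ring.genideal_ideal[OF ring_ring_of_type] by simp

lemma rel_ideal_closed:
  "0 \<in> rel_ideal R"
  "a \<in> rel_ideal R \<Longrightarrow> b \<in> rel_ideal R \<Longrightarrow> a + b \<in> rel_ideal R"
  "a \<in> rel_ideal R \<Longrightarrow> c * a \<in> rel_ideal R"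
  "a \<in> rel_ideal R \<Longrightarrow> a * c \<in> rel_ideal R"
  "r \<in> R \<Longrightarrow> r \<in> rel_ideal R"
proof -
  interpret I: ideal "rel_ideal R" ring_of_type by (rule ideal_rel_ideal)
  show "0 \<in> rel_ideal R" using additive_subgroup.zero_closed[OF I.additive_subgroup_axioms] by simp
  show "a \<in> rel_ideal R \<Longrightarrow> b \<in> rel_ideal R \<Longrightarrow> a + b \<in> rel_ideal R" using additive_subgroup.a_closed[OF I.additive_subgroup_axioms] by simp
  show "a \<in> rel_ideal R \<Longrightarrow> c * a \<in> rel_ideal R" using I.I_l_closed by simp
  show "a \<in> rel_ideal R \<Longrightarrow> a * c \<in> rel_ideal R" using I.I_r_closed by simp
  show "r \<in> R \<Longrightarrow> r \<in> rel_ideal R"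
    using ring.genideal_self[OF ring_ring_of_type, of R] by auto
qed

lemma rel_ideal_minus: "a \<in> rel_ideal R \<Longrightarrow> - a \<in> rel_ideal R"
  using rel_ideal_closed(3)[of a R "-1"] by simp

lemma rel_ideal_diff: "a \<in> rel_ideal R \<Longrightarrow> b \<in> rel_ideal R \<Longrightarrow> a - b \<in> rel_ideal R"
  using rel_ideal_closed(2)[of a R "-b"] rel_ideal_minus[of b R] by simp

lemma ideal_ring_of_typeI:
  assumes "0 \<in> I" "\<And>a b. a \<in> I \<Longrightarrow> b \<in> I \<Longrightarrow> a + b \<in> I"
    "\<And>a c. a \<in> I \<Longrightarrow> c * a \<in> I" "\<And>a c. a \<in> I \<Longrightarrow> a * c \<in> I"
  shows "ideal I (ring_of_type :: 'a::ring_1 ring)"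
proof (rule idealI[OF ring_ring_of_type])
  interpret ring "ring_of_type :: 'a ring" by (rule ring_ring_of_type)
  have inv: "\<ominus>\<^bsub>ring_of_type\<^esub> a = - a" for a :: 'a
    by (rule minus_equality) simp_all
  show "subgroup I (add_monoid (ring_of_type :: 'a ring))"
  proof (rule group.subgroupI[OF a_group])
    show "I \<noteq> {}" using assms(1) by auto
    fix a b assume ab: "a \<in> I" "b \<in> I"
    show "inv\<^bsub>add_monoid ring_of_type\<^esub> a \<in> I"
      using inv[of a] assms(3)[OF ab(1), of "-1"] by (simp add: a_inv_def)
    show "a \<otimes>\<^bsub>add_monoid ring_of_type\<^esub> b \<in> I"
      using assms(2)[OF ab] by simp
  qed simp
qed (use assms in auto)

lemma rel_ideal_subset:
  assumes "0 \<in> I" "\<And>a b. a \<in> I \<Longrightarrow> b \<in> I \<Longrightarrow> a + b \<in> I"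
    "\<And>a c. a \<in> I \<Longrightarrow> c * a \<in> I" "\<And>a c. a \<in> I \<Longrightarrow> a * c \<in> I" "R \<subseteq> I"
  shows "rel_ideal R \<subseteq> I"
  using ring.genideal_minimal[OF ring_ring_of_type ideal_ring_of_typeI[OF assms(1-4)] assms(5)] by auto

lemma coset_of_eq: "coset_of R a = {b. b - a \<in> rel_ideal R}"
proof -
  have "b \<in> rel_ideal R +>\<^bsub>ring_of_type\<^esub> a \<longleftrightarrow> b - a \<in> rel_ideal R" for b
    unfolding a_r_coset_def' by (auto intro!: bexI[of _ "b - a"])
  then show ?thesis by (auto simp: coset_of_def)
qed

lemma coset_of_eq_iff: "coset_of R a = coset_of R b \<longleftrightarrow> a - b \<in> rel_ideal R"
proof
  assume "coset_of R a = coset_of R b"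
  moreover have "a \<in> coset_of R a" by (simp add: coset_of_eq rel_ideal_closed)
  ultimately have "a \<in> coset_of R b" by (simp only:)
  then show "a - b \<in> rel_ideal R" by (simp add: coset_of_eq)
next
  assume *: "a - b \<in> rel_ideal R"
  have "c - a \<in> rel_ideal R \<longleftrightarrow> c - b \<in> rel_ideal R" for c
  proof
    assume "c - a \<in> rel_ideal R"
    from rel_ideal_closed(2)[OF this *] show "c - b \<in> rel_ideal R" by simp
  next
    assume "c - b \<in> rel_ideal R"
    from rel_ideal_diff[OF this *] show "c - a \<in> rel_ideal R" by simp
  qed
  then show "coset_of R a = coset_of R b" by (simp add: coset_of_eq)
qed

lemma ring_presented_algebra: "ring (presented_algebra R)"
  unfolding presented_algebra_def by (rule ideal.quotient_is_ring[OF ideal_rel_ideal])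

lemma coset_of_hom: "coset_of R \<in> ring_hom ring_of_type (presented_algebra R)"
  using ideal.rcos_ring_hom[OF ideal_rel_ideal, of R]
  by (simp add: presented_algebra_def coset_of_def[abs_def])

lemma carrier_presented_algebra: "carrier (presented_algebra R) = range (coset_of R)"
  by (auto simp: presented_algebra_def FactRing_def A_RCOSETS_def' coset_of_def)

lemma coset_of_simps:
  "coset_of R a \<otimes>\<^bsub>presented_algebra R\<^esub> coset_of R b = coset_of R (a * b)"
  "coset_of R a \<oplus>\<^bsub>presented_algebra R\<^esub> coset_of R b = coset_of R (a + b)"
  "\<one>\<^bsub>presented_algebra R\<^esub> = coset_of R 1"
  using ring_hom_mult[OF coset_of_hom, of a b R] ring_hom_add[OF coset_of_hom, of a b R]
    ring_hom_one[OF coset_of_hom, of R] by simp_all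

lemma the_elem_coset_of:
  assumes "\<And>r. r \<in> rel_ideal R \<Longrightarrow> F (a + r) = F a"
  shows "the_elem (F ` coset_of R a) = F a"
proof (rule the_elem_image_unique)
  show "coset_of R a \<noteq> {}" by (auto simp: coset_of_eq rel_ideal_closed intro!: exI[of _ a])
  fix b assume "b \<in> coset_of R a"
  then show "F b = F a" using assms[of "b - a"] by (simp add: coset_of_eq)
qed

lemma weyl_act_class: "weyl_act p (weyl_class a) q = free_act (exp_op p) a q"
  unfolding weyl_act_def weyl_class_def
proof (rule the_elem_coset_of)
  fix r assume "r \<in> rel_ideal (weyl_relations :: (weyl_gen, 'a) free_algebra set)"
  also have "\<dots> \<subseteq> {r. \<forall>q. free_act (exp_op p) r q = 0}"
    by (rule rel_ideal_subset)
       (use free_act_linear(2)[of p _ 0 0] in \<open>auto simp: free_act_add_left free_act_mult free_act_relation\<close>)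
  finally show "free_act (exp_op p) (a + r) q = free_act (exp_op p) a q"
    by (simp add: free_act_add_left)
qed

lemma peval_pCons: "peval (pCons c f) a = cst c + a * peval f (a :: ('g, 'k::comm_ring_1) free_algebra)"
proof (cases "f = 0")
  case False
  have "peval (pCons c f) a = cst c + (\<Sum>i\<le>degree f. cst (coeff f i) * a ^ Suc i)"
    using False by (simp add: peval_def sum.atMost_Suc_shift del: sum.atMost_Suc)
  also have "(\<Sum>i\<le>degree f. cst (coeff f i) * a ^ Suc i) = a * peval f a"
    unfolding peval_def sum_distrib_left
    by (intro sum.cong refl) (simp add: cst_comm[of _ a] flip: mult.assoc)
  finally show ?thesis .
qed (simp add: peval_def)

lemma peval_0 [simp]: "peval 0 a = 0" by (simp add: peval_def)
lemma peval_1 [simp]: "peval 1 a = 1" by (simp add: peval_def)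

lemma peval_add: "peval (f + g) a = peval f a + peval g (a :: ('g, 'k::comm_ring_1) free_algebra)"
  by (induction f g rule: poly_induct2) (simp_all add: peval_pCons cst_add algebra_simps)
lemma peval_smult: "peval (smult c f) a = cst c * peval f (a :: ('g, 'k::comm_ring_1) free_algebra)"
  by (induction f) (simp_all add: peval_pCons cst_mult distrib_left cst_comm[of c a] flip: mult.assoc)
lemma peval_mult: "peval (f * g) a = peval f a * peval g (a :: ('g, 'k::comm_ring_1) free_algebra)"
  by (induction f) (simp_all add: peval_pCons peval_add peval_smult distrib_right mult.assoc)
lemma peval_diff: "peval (f - g) a = peval f a - peval g (a :: ('g, 'k::comm_ring_1) free_algebra)"
  using peval_add[of "f - g" g a] by (simp add: algebra_simps)
lemma peval_comm: "a * peval f a = peval f a * (a :: ('g, 'k::comm_ring_1) free_algebra)"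
proof -
  have "[:0,1:] * f = f * [:0,1:]" by (rule mult.commute)
  from arg_cong[OF this, of "\<lambda>f. peval f a"] show ?thesis by (simp only: peval_mult) (simp add: peval_pCons)
qed
lemma peval_pcompose: "peval (f \<circ>\<^sub>p g) a = peval f (peval g (a :: ('g, 'k::comm_ring_1) free_algebra))"
  by (induction f) (simp_all add: pcompose_pCons peval_pCons peval_add peval_mult)
lemma peval_translate: "peval (translate c f) a = peval f (a + cst (c :: 'k::comm_ring_1))"
  by (simp add: translate_def peval_pcompose peval_pCons add.commute)

lemma weyl_cong_class: "weyl_class a = weyl_class b \<longleftrightarrow> a - b \<in> rel_ideal weyl_relations"
  by (simp add: weyl_class_def coset_of_eq_iff)

lemma weyl_class_mult_cong:
  assumes "weyl_class a = weyl_class a'" "weyl_class b = weyl_class b'"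
  shows "weyl_class (a * b) = weyl_class (a' * b')"
proof -
  have "a * b - a' * b' = (a - a') * b + a' * (b - b')" by (simp add: algebra_simps)
  then show ?thesis using assms by (simp add: weyl_cong_class rel_ideal_closed)
qed

lemma weyl_class_add_cong:
  assumes "weyl_class a = weyl_class a'" "weyl_class b = weyl_class b'"
  shows "weyl_class (a + b) = weyl_class (a' + b')"
proof -
  have "a + b - (a' + b') = (a - a') + (b - b')" by (simp add: algebra_simps)
  moreover have "(a - a') + (b - b') \<in> rel_ideal weyl_relations"
    by (rule rel_ideal_closed(2)) (use assms in \<open>simp_all add: weyl_cong_class\<close>)
  ultimately show ?thesis unfolding weyl_cong_class by (simp only:)
qed

lemma weyl_class_minus_cong:
  assumes "weyl_class a = weyl_class a'"
  shows "weyl_class (- a) = weyl_class (- a')"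
  using weyl_class_mult_cong[OF refl assms, of "-1"] by simp

lemma weyl_class_diff_cong:
  assumes "weyl_class a = weyl_class a'" "weyl_class b = weyl_class b'"
  shows "weyl_class (a - b) = weyl_class (a' - b')"
  using weyl_class_add_cong[OF assms(1) weyl_class_minus_cong[OF assms(2)]] by simp

lemma weyl_rel: "weyl_class (gen D_gen * gen T_gen) = weyl_class (gen T_gen * gen D_gen + 1)"
  unfolding weyl_cong_class by (rule rel_ideal_closed(5)) (simp add: weyl_relations_def diff_diff_eq)

lemma theta_t: "weyl_class ((theta l + cst c) * gen T_gen) = weyl_class (gen T_gen * (theta l + cst (c + 1)))"
proof -
  have e: "(theta l + cst c) * gen T_gen = gen T_gen * (gen D_gen * gen T_gen) + gen T_gen * cst (l + 1 + c)"
    unfolding theta_def by (simp add: cst_add distrib_left distrib_right mult.assoc cst_comm[of _ "gen T_gen"])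
  have "weyl_class ((theta l + cst c) * gen T_gen)
      = weyl_class (gen T_gen * (gen T_gen * gen D_gen + 1) + gen T_gen * cst (l + 1 + c))"
    unfolding e by (intro weyl_class_add_cong weyl_class_mult_cong refl weyl_rel)
  moreover have "gen T_gen * (gen T_gen * gen D_gen + 1) + gen T_gen * cst (l + 1 + c) = gen T_gen * (theta l + cst (c + 1))"
    by (simp add: theta_def algebra_simps cst_add)
  ultimately show ?thesis by simp
qed

lemma d_theta: "weyl_class (gen D_gen * (theta l + cst c)) = weyl_class ((theta l + cst (c + 1)) * gen D_gen)"
proof -
  have e: "gen D_gen * (theta l + cst c) = (gen D_gen * gen T_gen) * gen D_gen + cst (l + 1 + c) * gen D_gen"
    unfolding theta_def by (simp add: cst_add distrib_left distrib_right mult.assoc cst_comm[of _ "gen D_gen"])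
  have "weyl_class (gen D_gen * (theta l + cst c))
      = weyl_class ((gen T_gen * gen D_gen + 1) * gen D_gen + cst (l + 1 + c) * gen D_gen)"
    unfolding e by (intro weyl_class_add_cong weyl_class_mult_cong refl weyl_rel)
  moreover have "(gen T_gen * gen D_gen + 1) * gen D_gen + cst (l + 1 + c) * gen D_gen = (theta l + cst (c + 1)) * gen D_gen"
    by (simp add: theta_def algebra_simps cst_add)
  ultimately show ?thesis by simp
qed

lemma peval_push:
  assumes "weyl_class (a * z) = weyl_class (z * b)"
  shows "weyl_class (peval f a * z) = weyl_class (z * peval f b)"
proof (induction f)
  case (pCons c f)
  have "peval (pCons c f) a * z = cst c * z + a * (peval f a * z)"
    by (simp add: peval_pCons distrib_right mult.assoc)
  also have "weyl_class \<dots> = weyl_class (cst c * z + a * (z * peval f b))"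
    by (intro weyl_class_add_cong weyl_class_mult_cong refl pCons)
  also have "a * (z * peval f b) = (a * z) * peval f b" by (simp only: mult.assoc)
  also have "weyl_class (cst c * z + (a * z) * peval f b) = weyl_class (cst c * z + (z * b) * peval f b)"
    by (intro weyl_class_add_cong weyl_class_mult_cong refl assms)
  also have "cst c * z + (z * b) * peval f b = z * peval (pCons c f) b"
    by (simp add: peval_pCons distrib_left mult.assoc cst_comm[of c z])
  finally show ?case .
qed simp

lemma peval_t: "weyl_class (peval f (theta l + cst c) * gen T_gen) = weyl_class (gen T_gen * peval f (theta l + cst (c + 1)))"
  by (rule peval_push[OF theta_t])
lemma peval_d: "weyl_class (gen D_gen * peval f (theta l + cst c)) = weyl_class (peval f (theta l + cst (c + 1)) * gen D_gen)"
  by (rule peval_push[OF d_theta[symmetric], symmetric])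

lemma weyl_dt: "weyl_class (gen D_gen * gen T_gen) = weyl_class (theta l + cst (-l))"
  unfolding weyl_rel by (simp add: theta_def cst_add cst_minus)
lemma weyl_td: "gen T_gen * gen D_gen = theta l + cst (-l-1)"
  by (simp add: theta_def cst_add cst_minus flip: cst_add)

lemma poly_of_roots_dvd:
  assumes "X \<subseteq># proots f" "f \<noteq> 0"
  shows "poly_of_roots X dvd f"
  using assms
proof (induction X arbitrary: f)
  case empty
  then show ?case by (simp add: poly_of_roots_def)
next
  case (add a X)
  have "a \<in># proots f" using add.prems(1) by (meson mset_subset_eq_insertD)
  then have "poly f a = 0" using add.prems(2) by simp
  then obtain q where q: "f = [:-a, 1:] * q" by (auto simp: poly_eq_0_iff_dvd elim: dvdE)
  then have "q \<noteq> 0" using add.prems(2) by auto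
  then have "proots ([:-a, 1:] * q) = proots [:-a, 1:] + proots q" by (intro proots_mult) auto
  then have "proots f = add_mset a (proots q)" using q by simp
  then have "poly_of_roots X dvd q" using add \<open>q \<noteq> 0\<close> by auto
  then have "[:-a, 1:] * poly_of_roots X dvd [:-a, 1:] * q" by (rule mult_dvd_mono[OF dvd_refl])
  then show ?case unfolding q by (simp only: poly_of_roots_def image_mset_add_mset prod_mset.add_mset)
qed

lemma translate_mult: "translate c (f * g) = translate c f * translate c g"
  by (simp add: translate_def pcompose_mult)
lemma translate_translate: "translate c (translate d f) = translate (c + d) f"
  by (simp add: translate_def pcompose_pCons add_ac flip: pcompose_assoc)
lemma translate_0: "translate 0 f = f"
  by (simp add: translate_def)
lemma translate_linear: "translate c [:a, b:] = [:a + b * c, b:]"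
  by (simp add: translate_def pcompose_pCons mult.commute)
lemmas translate_simps = translate_mult translate_translate translate_0 translate_linear

lemma P_poly_eq:
  assumes "lam \<in># proots (u + [:C:])" "X \<subseteq># proots (u + [:C:]) - {#lam#}"
  shows "P_poly u C lam X * (translate (-1) (poly_of_roots X) * [:-(lam + 1), 1:]) =
         translate (-1) (u + [:C:])"
proof -
  let ?f = "u + [:C:]"
  have f0: "?f \<noteq> 0" using assms(1) by auto
  have "add_mset lam X \<subseteq># proots ?f"
    using assms by (metis insert_subset_eq_iff)
  then have "poly_of_roots (add_mset lam X) dvd ?f"
    by (rule poly_of_roots_dvd) (rule f0)
  then have "translate (-1) (poly_of_roots (add_mset lam X)) dvd translate (-1) ?f"
    by (auto simp: translate_def pcompose_mult elim!: dvdE)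
  moreover have "translate (-1) (poly_of_roots (add_mset lam X)) =
     translate (-1) (poly_of_roots X) * [:-(lam + 1), 1:]"
    unfolding poly_of_roots_def image_mset_add_mset prod_mset.add_mset translate_mult translate_linear
    by (simp only: mult.commute) simp
  moreover have "translate (-1) ?f = translate (-1) u + [:C:]"
    by (simp add: translate_def pcompose_add)
  ultimately show ?thesis
    unfolding P_poly_def by (metis dvd_div_mult_self)
qed

lemma phi_relation:
  assumes lam: "lam \<in># proots (u + [:C:])" and X: "X \<subseteq># proots (u + [:C:]) - {#lam#}"
    and r: "r \<in> smith_relations u"
  shows "weyl_class (subst (phi_gen u C lam X) r) = weyl_class 0"
proof -
  let ?T = "gen T_gen :: (weyl_gen, 'a) free_algebra" and ?D = "gen D_gen :: (weyl_gen, 'a) free_algebra"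
  let ?h = "theta lam"
  define Q where "Q = poly_of_roots X"
  define P where "P = P_poly u C lam X"
  have PQ: "P * (translate (-1) Q * [:-(lam + 1), 1:]) = translate (-1) (u + [:C:])"
    unfolding P_def Q_def by (rule P_poly_eq[OF lam X])
  have "translate 1 (P * (translate (-1) Q * [:-(lam + 1), 1:])) = translate 1 P * (Q * [:-lam, 1:])"
    by (simp only: translate_simps) (simp add: translate_0)
  then have PQ1: "translate 1 P * (Q * [:-lam, 1:]) = u + [:C:]"
    unfolding PQ by (simp add: translate_translate translate_0)
  have hT: "weyl_class (?h * ?T) = weyl_class (?T * (?h + 1))"
    using theta_t[of lam 0] by simp
  have hD: "weyl_class (?h * ?D) = weyl_class (?D * (?h - 1))"
    using d_theta[of lam "-1"] by (simp add: cst_minus)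
  have PD: "weyl_class (peval P (?h + 1) * ?D) = weyl_class (?D * peval P ?h)"
    using peval_d[of P lam 0] by simp
  have QT: "weyl_class (peval Q (?h - 1) * ?T) = weyl_class (?T * peval Q ?h)"
    using peval_t[of Q lam "-1"] by (simp add: cst_minus)
  have y: "weyl_class ((?h * (?T * peval P (?h + 1)) - (?T * peval P (?h + 1)) * ?h) - ?T * peval P (?h + 1)) = weyl_class 0"
  proof -
    have "(?h * (?T * peval P (?h + 1)) - (?T * peval P (?h + 1)) * ?h) - ?T * peval P (?h + 1)
       = (?h * ?T) * peval P (?h + 1) - ?T * (peval P (?h + 1) * (?h + 1))"
      by (simp add: algebra_simps)
    moreover have "weyl_class ((?h * ?T) * peval P (?h + 1) - ?T * (peval P (?h + 1) * (?h + 1)))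
       = weyl_class ((?T * (?h + 1)) * peval P (?h + 1) - ?T * (peval P (?h + 1) * (?h + 1)))"
      by (intro weyl_class_diff_cong weyl_class_mult_cong[OF hT] refl)
    moreover have "(?T * (?h + 1)) * peval P (?h + 1) - ?T * (peval P (?h + 1) * (?h + 1)) = 0"
      using peval_comm[of "?h + 1" P] by (simp only: mult.assoc) simp
    ultimately show ?thesis by simp
  qed
  have x: "weyl_class ((?h * (?D * peval Q (?h - 1)) - (?D * peval Q (?h - 1)) * ?h) - (- (?D * peval Q (?h - 1)))) = weyl_class 0"
  proof -
    have "(?h * (?D * peval Q (?h - 1)) - (?D * peval Q (?h - 1)) * ?h) - (- (?D * peval Q (?h - 1)))
       = (?h * ?D) * peval Q (?h - 1) - ?D * (peval Q (?h - 1) * (?h - 1))"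
      by (simp add: algebra_simps)
    moreover have "weyl_class ((?h * ?D) * peval Q (?h - 1) - ?D * (peval Q (?h - 1) * (?h - 1)))
       = weyl_class ((?D * (?h - 1)) * peval Q (?h - 1) - ?D * (peval Q (?h - 1) * (?h - 1)))"
      by (intro weyl_class_diff_cong weyl_class_mult_cong[OF hD] refl)
    moreover have "(?D * (?h - 1)) * peval Q (?h - 1) - ?D * (peval Q (?h - 1) * (?h - 1)) = 0"
      using peval_comm[of "?h - 1" Q] by (simp only: mult.assoc) simp
    ultimately show ?thesis by simp
  qed
  have xy: "weyl_class (((?T * peval P (?h + 1)) * (?D * peval Q (?h - 1)) -
      (?D * peval Q (?h - 1)) * (?T * peval P (?h + 1))) - peval (translate (-1) u - u) ?h) = weyl_class 0"
  proof -
    have "weyl_class ((?T * peval P (?h + 1)) * (?D * peval Q (?h - 1)))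
        = weyl_class (?T * (peval P (?h + 1) * ?D) * peval Q (?h - 1))"
      by (simp add: mult.assoc)
    also have "\<dots> = weyl_class (?T * (?D * peval P ?h) * peval Q (?h - 1))"
      by (rule weyl_class_mult_cong[OF weyl_class_mult_cong[OF refl PD] refl])
    also have "?T * (?D * peval P ?h) * peval Q (?h - 1) = (?T * ?D) * (peval P ?h * peval Q (?h - 1))"
      by (simp add: mult.assoc)
    also have "\<dots> = peval ([:-(lam + 1), 1:] * (P * translate (-1) Q)) ?h"
      unfolding weyl_td[of lam] peval_mult peval_translate
      by (simp add: peval_pCons cst_minus add.commute[of "cst _" "theta lam"] mult.assoc)
    also have "[:-(lam + 1), 1:] * (P * translate (-1) Q) = translate (-1) (u + [:C:])"
      unfolding PQ[symmetric] by (simp only: mult_ac)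
    finally have 1: "weyl_class ((?T * peval P (?h + 1)) * (?D * peval Q (?h - 1))) =
       weyl_class (peval (translate (-1) (u + [:C:])) ?h)" .
    have "weyl_class ((?D * peval Q (?h - 1)) * (?T * peval P (?h + 1)))
        = weyl_class (?D * (peval Q (?h - 1) * ?T) * peval P (?h + 1))"
      by (simp add: mult.assoc)
    also have "\<dots> = weyl_class (?D * (?T * peval Q ?h) * peval P (?h + 1))"
      by (rule weyl_class_mult_cong[OF weyl_class_mult_cong[OF refl QT] refl])
    also have "?D * (?T * peval Q ?h) * peval P (?h + 1) = (?D * ?T) * (peval Q ?h * peval P (?h + 1))"
      by (simp add: mult.assoc)
    also have "weyl_class \<dots> = weyl_class ((?h + cst (-lam)) * (peval Q ?h * peval P (?h + 1)))"
      by (rule weyl_class_mult_cong[OF weyl_dt refl])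
    also have "(?h + cst (-lam)) * (peval Q ?h * peval P (?h + 1)) = peval ([:-lam, 1:] * (Q * translate 1 P)) ?h"
      unfolding peval_mult peval_translate
      by (simp add: peval_pCons cst_minus algebra_simps)
    also have "[:-lam, 1:] * (Q * translate 1 P) = u + [:C:]"
      unfolding PQ1[symmetric] by (simp only: mult_ac)
    finally have 2: "weyl_class ((?D * peval Q (?h - 1)) * (?T * peval P (?h + 1))) = weyl_class (peval (u + [:C:]) ?h)" .
    have "translate (-1) (u + [:C:]) - (u + [:C:]) = translate (-1) u - u"
      by (simp add: translate_def pcompose_add)
    then have "(peval (translate (-1) (u + [:C:])) ?h - peval (u + [:C:]) ?h) - peval (translate (-1) u - u) ?h = 0"
      by (simp only: peval_diff[symmetric] diff_self peval_0)
    then show ?thesis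
      using weyl_class_diff_cong[OF weyl_class_diff_cong[OF 1 2] refl, of "peval (translate (-1) u - u) ?h"]
      by (simp only:)
  qed
  from r x y xy show ?thesis
    unfolding smith_relations_def Let_def Q_def P_def
    by (elim insertE emptyE; simp only: subst_diff subst_mult subst_minus subst_gen subst_peval phi_gen.simps)
qed

lemma phi_class:
  assumes "lam \<in># proots (u + [:C:])" "X \<subseteq># proots (u + [:C:]) - {#lam#}"
  shows "phi u C lam X (smith_class u a) = weyl_class (subst (phi_gen u C lam X) a)"
  unfolding phi_def smith_class_def
proof (rule the_elem_coset_of)
  fix r assume "r \<in> rel_ideal (smith_relations u)"
  also have "\<dots> \<subseteq> {r. weyl_class (subst (phi_gen u C lam X) r) = weyl_class 0}"
  proof (rule rel_ideal_subset)
    show "smith_relations u \<subseteq> {r. weyl_class (subst (phi_gen u C lam X) r) = weyl_class 0}"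
      using phi_relation[OF assms] by auto
  qed (use weyl_class_add_cong[of _ 0 _ 0] weyl_class_mult_cong[of _ 0 _ _, OF _ refl]
        weyl_class_mult_cong[of _ _ _ 0, OF refl] in \<open>simp_all add: subst_add subst_mult\<close>)
  finally show "weyl_class (subst (phi_gen u C lam X) (a + r)) = weyl_class (subst (phi_gen u C lam X) a)"
    using weyl_class_add_cong[OF refl, of "subst (phi_gen u C lam X) r" 0] by (simp add: subst_add)
qed

lemma phi_hom:
  assumes "lam \<in># proots (u + [:C:])" "X \<subseteq># proots (u + [:C:]) - {#lam#}"
  shows "phi u C lam X \<in> ring_hom (smith_algebra u) weyl_algebra"
proof (rule ring_hom_memI)
  fix s assume "s \<in> carrier (smith_algebra u)"
  then show "phi u C lam X s \<in> carrier weyl_algebra"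
    by (auto simp: smith_algebra_def weyl_algebra_def carrier_presented_algebra weyl_class_def
        phi_class[OF assms, unfolded smith_class_def])
next
  fix s t assume "s \<in> carrier (smith_algebra u)" "t \<in> carrier (smith_algebra u)"
  then show "phi u C lam X (s \<otimes>\<^bsub>smith_algebra u\<^esub> t) = phi u C lam X s \<otimes>\<^bsub>weyl_algebra\<^esub> phi u C lam X t"
    and "phi u C lam X (s \<oplus>\<^bsub>smith_algebra u\<^esub> t) = phi u C lam X s \<oplus>\<^bsub>weyl_algebra\<^esub> phi u C lam X t"
    by (auto simp: smith_algebra_def weyl_algebra_def carrier_presented_algebra weyl_class_def
        phi_class[OF assms, unfolded smith_class_def] coset_of_simps subst_mult subst_add)
next
  show "phi u C lam X \<one>\<^bsub>smith_algebra u\<^esub> = \<one>\<^bsub>weyl_algebra\<^esub>"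
    by (simp add: smith_algebra_def weyl_algebra_def weyl_class_def
        phi_class[OF assms, unfolded smith_class_def] coset_of_simps)
qed

lemma left_module_weyl_act: "left_module weyl_algebra (weyl_act p)"
proof -
  have W: "ring weyl_algebra" unfolding weyl_algebra_def by (rule ring_presented_algebra)
  show ?thesis
    by (intro left_module.intro left_module_axioms.intro W)
       (auto simp: weyl_algebra_def carrier_presented_algebra coset_of_simps free_act_add_left
         free_act_mult free_act_linear weyl_act_class[unfolded weyl_class_def])
qed

lemma left_module_exp_act:
  assumes "lam \<in># proots (u + [:C:])" "X \<subseteq># proots (u + [:C:]) - {#lam#}"
  shows "left_module (smith_algebra u) (exp_act u p C lam X)"
proof -
  interpret W: left_module weyl_algebra "weyl_act p" by (rule left_module_weyl_act)
  have S: "ring (smith_algebra u)" unfolding smith_algebra_def by (rule ring_presented_algebra)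
  note h = phi_hom[OF assms]
  show ?thesis
    by (intro left_module.intro left_module_axioms.intro S)
       (simp_all add: exp_act_def W.act_add_right W.act_add_left W.act_mult W.act_one
         ring_hom_closed[OF h] ring_hom_add[OF h] ring_hom_mult[OF h] ring_hom_one[OF h])
qed

lemma exp_act_class:
  assumes "lam \<in># proots (u + [:C:])" "X \<subseteq># proots (u + [:C:]) - {#lam#}"
  shows "exp_act u p C lam X (smith_class u a) q = free_act (exp_op p) (subst (phi_gen u C lam X) a) q"
  by (simp add: exp_act_def phi_class[OF assms] weyl_act_class)

end

theory Submission
  imports Defs
begin

text \<open>
  Both halves rest on the operator by which \<open>h\<close> acts on \<open>q e\<^sup>p\<close>, namely
  \<open>q \<mapsto> t (q' + q p') + (\<lambda> + 1) q\<close>.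

  Freeness is a matter of degrees. Since \<open>t p'\<close> has degree \<open>n = deg p \<ge> 1\<close>, the term \<open>t q p'\<close>
  dominates and \<open>h\<close> raises every degree by exactly \<open>n\<close>; this is where characteristic zero
  enters, as it keeps the leading coefficient of \<open>t p'\<close> nonzero. So \<open>f(h)\<close> raises degrees by
  \<open>n deg f\<close> (\<open>degree_h_act\<close>). Applied to \<open>1, t, \<dots>, t\<^sup>n\<^sup>-\<^sup>1\<close>, the powers of \<open>h\<close> hit every
  degree, which gives generation by division with remainder of the degree by \<open>n\<close>. In a relation
  the terms with different \<open>t\<^sup>i\<close> have degrees in different classes modulo \<open>n\<close> and cannot
  cancel, which gives independence.

  For simplicity, take \<open>X\<close> to be all roots but one copy of \<open>\<lambda>\<close>. Then \<open>P\<^sub>X\<close> is a nonzero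
  constant (\<open>P_poly_full\<close>), so \<open>y\<close> acts as a multiple of \<open>t\<close> and a submodule \<open>N\<close> is an ideal
  of the polynomial ring. Subtracting multiples of \<open>q\<close> from \<open>h q\<close> leaves \<open>t q'\<close>, so \<open>N\<close> is
  also stable under the Euler operator \<open>t d/dt\<close>, and an element of least degree \<open>d\<close> in a nonzero
  \<open>N\<close> must be a multiple of \<open>t\<^sup>d\<close>. Finally \<open>x\<close> sends \<open>t\<^sup>d\<close> to
  \<open>d Q\<^sub>X(\<lambda> + d) t\<^sup>d\<^sup>-\<^sup>1\<close> plus a multiple of \<open>t\<^sup>d\<close>. If \<open>d \<ge> 1\<close>, the hypothesis on the roots
  gives \<open>Q\<^sub>X(\<lambda> + d) \<noteq> 0\<close>, so \<open>t\<^sup>d\<^sup>-\<^sup>1\<close> lies in \<open>N\<close> as well, against the choice of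
  \<open>d\<close>. Hence \<open>d = 0\<close> and \<open>N\<close> is everything.
\<close>

section \<open>The action of \<open>\<bbbk>[h]\<close>\<close>

definition h_act :: "'k::field poly \<Rightarrow> 'k \<Rightarrow> 'k poly \<Rightarrow> 'k poly \<Rightarrow> 'k poly" where
  "h_act p lam f q = free_act (exp_op p) (peval f (theta lam)) q"

lemma exp_h_scale_eq:
  assumes "lam \<in># proots (u + [:C:])" "X \<subseteq># proots (u + [:C:]) - {#lam#}"
  shows "exp_h_scale u p C lam X = h_act p lam"
  by (intro ext) (simp add: exp_h_scale_def exp_act_class[OF assms] subst_peval h_act_def)

lemma free_act_theta:
  "free_act (exp_op p) (theta lam) q =
     [:0, 1:] * (pderiv q + q * pderiv p) + smult (lam + 1) q"
  by (simp add: theta_def free_act_add_left free_act_mult)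

lemma h_act_0 [simp]: "h_act p lam 0 q = 0"
  by (simp add: h_act_def)

lemma h_act_pCons:
  "h_act p lam (pCons c f) q =
     smult c q + ([:0, 1:] * (pderiv (h_act p lam f q) + h_act p lam f q * pderiv p)
       + smult (lam + 1) (h_act p lam f q))"
  by (simp only: h_act_def peval_pCons free_act_add_left free_act_mult free_act_cst free_act_theta)

lemma h_act_const [simp]: "h_act p lam [:c:] q = smult c q"
  by (simp add: h_act_pCons)

lemma module_h_act: "Modules.module (h_act p lam)"
proof -
  have "peval f (theta lam) * peval g (theta lam) = peval (f * g) (theta lam)" for f g
    by (simp add: peval_mult)
  then show ?thesis
    by unfold_locales
       (simp_all add: h_act_def peval_add free_act_add_left free_act_linear flip: free_act_mult)
qed

section \<open>Freeness over \<open>\<bbbk>[h]\<close>\<close>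

text \<open>The summand \<open>t q p'\<close> strictly dominates \<open>t q'\<close> and \<open>c q\<close>, whose degrees are at most
  that of \<open>q\<close>.\<close>

lemma degree_theta:
  fixes q p :: "'k::field_char_0 poly"
  assumes "degree p \<ge> 1" "q \<noteq> 0"
  shows "degree ([:0, 1:] * (pderiv q + q * pderiv p) + smult c q) = degree q + degree p"
proof -
  have p': "pderiv p \<noteq> 0" using assms(1) by (simp add: pderiv_eq_0_iff)
  have main: "degree ([:0, 1:] * (q * pderiv p)) = degree q + degree p"
    using assms p' by (simp add: degree_mult_eq degree_pderiv)
  have "degree ([:0, 1:] * pderiv q + smult c q) \<le> degree q"
  proof (rule degree_add_le)
    show "degree ([:0, 1:] * pderiv q) \<le> degree q"
      using assms(2) by (cases "pderiv q = 0") (auto simp: degree_pderiv pderiv_eq_0_iff)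
  qed (rule degree_smult_le)
  also have "\<dots> < degree ([:0, 1:] * (q * pderiv p))" using main assms(1) by simp
  finally have "degree ([:0, 1:] * (q * pderiv p) + ([:0, 1:] * pderiv q + smult c q)) =
      degree ([:0, 1:] * (q * pderiv p))"
    by (rule degree_add_eq_left)
  moreover have "[:0, 1:] * (q * pderiv p) + ([:0, 1:] * pderiv q + smult c q) =
      [:0, 1:] * (pderiv q + q * pderiv p) + smult c q"
    by (simp only: distrib_left add_ac)
  ultimately show ?thesis using main by metis
qed

text \<open>In Horner form each further factor \<open>h\<close> raises the degree by \<open>deg p \<ge> 1\<close>, so the
  scalar multiple of \<open>q\<close> added after it is too low to interfere.\<close>

lemma degree_h_act:
  fixes q p :: "'k::field_char_0 poly"
  assumes "degree p \<ge> 1" "q \<noteq> 0" "f \<noteq> 0"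
  shows "h_act p lam f q \<noteq> 0" "degree (h_act p lam f q) = degree q + degree p * degree f"
proof -
  have "h_act p lam f q \<noteq> 0 \<and> degree (h_act p lam f q) = degree q + degree p * degree f"
    using assms(3)
  proof (induction f)
    case (pCons c f)
    show ?case
    proof (cases "f = 0")
      case True
      then show ?thesis using pCons assms(2) by simp
    next
      case False
      let ?v = "h_act p lam f q"
      let ?w = "[:0, 1:] * (pderiv ?v + ?v * pderiv p) + smult (lam + 1) ?v"
      from pCons False have v: "?v \<noteq> 0" "degree ?v = degree q + degree p * degree f" by auto
      then have w: "degree ?w = degree q + degree p * degree (pCons c f)"
        using degree_theta[OF assms(1) v(1), of "lam + 1"] False by simp
      have "degree (smult c q) \<le> degree q" by (rule degree_smult_le)
      also have "\<dots> < degree ?w" unfolding w using assms(1) False by simp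
      finally have "degree (smult c q) < degree ?w" .
      from degree_add_eq_right[OF this]
      have deg: "degree (h_act p lam (pCons c f) q) = degree q + degree p * degree (pCons c f)"
        unfolding h_act_pCons w .
      moreover have "0 < degree p * degree (pCons c f)" using assms(1) False by simp
      ultimately have "h_act p lam (pCons c f) q \<noteq> 0"
        by (metis add_is_0 degree_0 less_numeral_extra(3))
      with deg show ?thesis by blast
    qed
  qed simp
  then show "h_act p lam f q \<noteq> 0" "degree (h_act p lam f q) = degree q + degree p * degree f"
    by blast+
qed

text \<open>The leading term of the summand of largest degree cannot cancel.\<close>

lemma sum_eq_0_distinct_degrees:
  fixes v :: "'a \<Rightarrow> 'k::comm_ring_1 poly"
  assumes "finite A" "(\<Sum>a\<in>A. v a) = 0"
    and "\<And>a b. \<lbrakk>a \<in> A; b \<in> A; v a \<noteq> 0; v b \<noteq> 0; degree (v a) = degree (v b)\<rbrakk> \<Longrightarrow> a = b"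
    and "a \<in> A"
  shows "v a = 0"
proof (rule ccontr)
  assume "v a \<noteq> 0"
  define S where "S = {b \<in> A. v b \<noteq> 0}"
  have S: "finite S" "S \<noteq> {}" using assms(1,4) \<open>v a \<noteq> 0\<close> by (auto simp: S_def)
  have "Max ((\<lambda>b. degree (v b)) ` S) \<in> (\<lambda>b. degree (v b)) ` S"
    using S by (intro Max_in) auto
  then obtain m where m: "m \<in> S" "Max ((\<lambda>b. degree (v b)) ` S) = degree (v m)" by auto
  then have m_max: "degree (v b) \<le> degree (v m)" if "b \<in> S" for b
    using Max_ge[OF finite_imageI[OF S(1)] imageI[OF that], of "\<lambda>b. degree (v b)"]
    by (simp only: m(2))
  have "coeff (v b) (degree (v m)) = (if b = m then lead_coeff (v m) else 0)" if "b \<in> A" for b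
  proof (cases "v b = 0 \<or> b = m")
    case False
    then have "b \<in> S" "b \<noteq> m" using that by (auto simp: S_def)
    moreover have "degree (v b) \<noteq> degree (v m)"
      using assms(3)[of b m] m(1) \<open>b \<in> S\<close> \<open>b \<noteq> m\<close> unfolding S_def by blast
    ultimately have "degree (v b) < degree (v m)"
      using m_max[of b] by linarith
    then show ?thesis using False by (simp add: coeff_eq_0)
  qed (use m(1) in \<open>auto simp: S_def\<close>)
  then have "(\<Sum>b\<in>A. coeff (v b) (degree (v m))) = (\<Sum>b\<in>A. if b = m then lead_coeff (v m) else 0)"
    by (rule sum.cong[OF refl])
  also have "\<dots> = lead_coeff (v m)" using m(1) assms(1) by (simp add: S_def)
  finally have "coeff (\<Sum>b\<in>A. v b) (degree (v m)) = lead_coeff (v m)" by (simp only: coeff_sum)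
  then show False using m(1) assms(2) by (simp add: S_def)
qed

lemma free_module_h_act:
  fixes p :: "'k::field_char_0 poly"
  assumes "degree p \<ge> 1"
  shows "free_module_of_rank (h_act p lam) (degree p)"
proof -
  interpret M: Modules.module "h_act p lam" by (rule module_h_act)
  define n where "n = degree p"
  define B where "B = (\<lambda>i. monom (1::'k) i) ` {..<n}"
  have B: "v \<noteq> 0" "degree v < n" if "v \<in> B" for v
    using that by (auto simp: B_def degree_monom_eq)
  have inj: "v = w" if "v \<in> B" "w \<in> B" "degree v = degree w" for v w
    using that by (auto simp: B_def degree_monom_eq)
  have card: "card B = n"
    unfolding B_def by (subst card_image) (auto simp: inj_on_def monom_eq_iff')
  have "M.independent B"
    unfolding M.independent_explicit_module
  proof (intro allI impI)
    fix T f v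
    assume T: "finite T" "T \<subseteq> B" "(\<Sum>v\<in>T. h_act p lam (f v) v) = 0" and v: "v \<in> T"
    have "h_act p lam (f v) v = 0"
    proof (rule sum_eq_0_distinct_degrees[OF T(1) T(3) _ v])
      fix a b
      assume ab: "a \<in> T" "b \<in> T" and nz: "h_act p lam (f a) a \<noteq> 0" "h_act p lam (f b) b \<noteq> 0"
        and deg: "degree (h_act p lam (f a) a) = degree (h_act p lam (f b) b)"
      have ab': "a \<in> B" "b \<in> B" using ab T(2) by auto
      have fz: "f a \<noteq> 0" "f b \<noteq> 0" using nz by auto
      have "degree a + n * degree (f a) = degree b + n * degree (f b)"
        using deg degree_h_act(2)[OF assms B(1)] ab' fz by (simp add: n_def)
      \<comment> \<open>Basis elements have degree below \<open>n\<close>, so the residue modulo \<open>n\<close> recovers them.\<close>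
      then have "(degree a + n * degree (f a)) mod n = (degree b + n * degree (f b)) mod n" by simp
      then have "degree a = degree b" using B(2) ab' by simp
      then show "a = b" using inj ab' by blast
    qed
    then show "f v = 0" using degree_h_act(1)[OF assms B(1)] v T(2) by blast
  qed
  moreover have "q \<in> M.span B" for q
  \<comment> \<open>The measure places the zero polynomial below the nonzero constants, so that each reduction
    step decreases it.\<close>
  proof (induction "if q = 0 then 0 else Suc (degree q)" arbitrary: q rule: less_induct)
    case (less q)
    show ?case
    proof (cases "q = 0")
      case True
      then show ?thesis by (simp add: M.span_zero)
    next
      case False
      \<comment> \<open>Since \<open>h\<close> adds \<open>n\<close> to the degree, \<open>h\<^sup>k t\<^sup>i\<close> with \<open>k\<close> and \<open>i\<close> the quotient and
        remainder of \<open>deg q\<close> by \<open>n\<close> has the degree of \<open>q\<close> and can cancel its leading term.\<close>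
      define b :: "'k poly" where "b = monom 1 (degree q mod n)"
      define v where "v = h_act p lam (monom 1 (degree q div n)) b"
      have b: "b \<in> B" using assms by (auto simp: B_def b_def n_def)
      have deg: "degree v = degree q"
        unfolding v_def
        by (subst degree_h_act(2)[OF assms B(1)[OF b]]) (simp_all add: b_def degree_monom_eq flip: n_def)
      have v0: "v \<noteq> 0"
        unfolding v_def by (rule degree_h_act(1)[OF assms B(1)[OF b]]) simp
      have vB: "v \<in> M.span B"
        unfolding v_def by (intro M.span_scale M.span_base b)
      define a where "a = lead_coeff q / lead_coeff v"
      let ?r = "q - h_act p lam [:a:] v"
      have "?r \<in> M.span B"
      proof (rule less)
        have "degree ?r \<le> degree q"
          using degree_diff_le[of q "degree q" "smult a v"] degree_smult_le[of a v] deg by simp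
        moreover have "coeff v (degree q) \<noteq> 0" using v0 deg by (metis leading_coeff_0_iff)
        then have "coeff ?r (degree q) = 0" by (simp add: a_def deg)
        ultimately have "?r \<noteq> 0 \<Longrightarrow> degree ?r < degree q" by (rule degree_less_if_less_eqI)
        then show "(if ?r = 0 then 0 else Suc (degree ?r)) < (if q = 0 then 0 else Suc (degree q))"
          using False by auto
      qed
      then have "?r + h_act p lam [:a:] v \<in> M.span B" by (intro M.span_add M.span_scale vB)
      then show ?thesis by simp
    qed
  qed
  ultimately show ?thesis
    unfolding free_module_of_rank_def n_def[symmetric]
    using card module_h_act by (intro conjI exI[of _ B]) (auto simp: B_def)
qed

section \<open>Simplicity\<close>

text \<open>Conjugating the Euler operator by \<open>t\<^sup>d\<close> adds \<open>d\<close>, so the action on multiples of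
  \<open>t\<^sup>d\<close> is the action on all polynomials for a shifted \<open>\<lambda>\<close>.\<close>

lemma h_act_monom_mult:
  "h_act p lam f (monom 1 d * q) = monom 1 d * h_act p (lam + of_nat d) f q"
proof (induction f)
  case (pCons c f)
  define w where "w = h_act p (lam + of_nat d) f q"
  let ?t = "[:0, 1:] :: 'a poly" and ?m = "monom (1::'a) d"
  have "?t * pderiv ?m = smult (of_nat d) ?m"
    by (rule poly_eqI) (simp add: coeff_pCons coeff_pderiv split: nat.split)
  then have "(?t * pderiv ?m) * w = smult (of_nat d) (?m * w)"
    by (simp only: mult_smult_left)
  moreover have "?t * pderiv (?m * w) = (?t * pderiv ?m) * w + ?m * (?t * pderiv w)"
    unfolding pderiv_mult distrib_left by (simp only: ac_simps)
  ultimately have "?t * pderiv (?m * w) = smult (of_nat d) (?m * w) + ?m * (?t * pderiv w)"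
    by (simp only:)
  moreover have "?t * (?m * w * pderiv p) = ?m * (?t * (w * pderiv p))"
    by (simp only: mult_ac)
  ultimately show ?case
    unfolding h_act_pCons pCons.IH w_def[symmetric] distrib_left
    by (simp only: mult_smult_right smult_add_left distrib_left add_ac)
qed simp

text \<open>Modulo \<open>t\<close> the operator \<open>h\<close> is the scalar \<open>\<lambda> + 1\<close>. Together with the shift above this
  yields the coefficient of \<open>t\<^sup>d\<close> in \<open>f(h) t\<^sup>d\<close>.\<close>

lemma poly_h_act_0: "poly (h_act p lam f q) 0 = poly f (lam + 1) * poly q 0"
proof (induction f)
  case (pCons c f)
  have "poly (h_act p lam (pCons c f) q) 0 = c * poly q 0 + (lam + 1) * poly (h_act p lam f q) 0"
    unfolding h_act_pCons by simp
  then show ?case unfolding pCons.IH by (simp only: poly_pCons distrib_right mult.assoc)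
qed simp

lemma proots_factorization:
  fixes f :: "'k::alg_closed_field poly"
  assumes "f \<noteq> 0"
  shows "f = smult (lead_coeff f) (poly_of_roots (proots f))"
proof -
  obtain A where A: "f = smult (lead_coeff f) (\<Prod>x\<in>#A. [:-x, 1:])"
    using alg_closed_imp_factorization[OF assms] by blast
  have "proots (\<Prod>x\<in>#A. [:-x, 1:]) = A"
  proof (induction A)
    case (add a A)
    have "(\<Prod>x\<in>#A. [:-x, 1:]) \<noteq> 0" by (auto simp: prod_mset_zero_iff)
    then have "proots ([:-a, 1:] * (\<Prod>x\<in>#A. [:-x, 1:])) = {#a#} + A"
      by (subst proots_mult) (simp_all add: add)
    then show ?case by (simp del: mult_pCons_left)
  qed simp
  then have "proots (smult (lead_coeff f) (\<Prod>x\<in>#A. [:-x, 1:])) = A" using assms by simp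
  then have "proots f = A" unfolding A[symmetric] .
  show ?thesis unfolding poly_of_roots_def \<open>proots f = A\<close> by (rule A)
qed

lemma poly_poly_of_roots_eq_0_iff: "poly (poly_of_roots X) a = 0 \<longleftrightarrow> a \<in># X"
proof (induction X)
  case (add b X)
  have "poly (poly_of_roots (add_mset b X)) a = (a - b) * poly (poly_of_roots X) a"
    by (simp add: poly_of_roots_def algebra_simps)
  then show ?case using add.IH by (simp only: mult_eq_0_iff) auto
qed (simp add: poly_of_roots_def)

text \<open>With the maximal choice of \<open>X\<close>, the divisor defining \<open>P\<^sub>X\<close> contains every linear factor of
  \<open>u(h - 1) + C\<close>, because the field is algebraically closed; only the leading coefficient remains.\<close>

lemma P_poly_full:
  fixes u :: "'k::alg_closed_field poly"
  assumes "lam \<in># proots (u + [:C:])"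
  shows "P_poly u C lam (proots (u + [:C:]) - {#lam#}) = [:lead_coeff (u + [:C:]):]"
proof -
  let ?f = "u + [:C:]"
  let ?X = "proots ?f - {#lam#}"
  let ?D = "translate (-1) (poly_of_roots ?X) * [:-(lam + 1), 1:]"
  have f0: "?f \<noteq> 0" using assms by auto
  have tr0: "translate (-1) h = 0 \<Longrightarrow> h = 0" for h :: "'k poly"
    using translate_translate[of 1 "-1" h] by (simp add: translate_0) (simp add: translate_def)
  have "proots ?f = add_mset lam ?X" using assms by simp
  then have "?f = smult (lead_coeff ?f) (poly_of_roots (add_mset lam ?X))"
    using proots_factorization[OF f0] by metis
  also have "\<dots> = [:lead_coeff ?f:] * (poly_of_roots ?X * [:-lam, 1:])"
    by (simp add: poly_of_roots_def mult.commute)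
  finally have "translate (-1) ?f = translate (-1) ([:lead_coeff ?f:] * (poly_of_roots ?X * [:-lam, 1:]))"
    by (rule arg_cong)
  also have "\<dots> = [:lead_coeff ?f:] * ?D"
    unfolding translate_mult by (simp add: translate_def pcompose_pCons)
  finally have "translate (-1) ?f = [:lead_coeff ?f:] * ?D" .
  moreover have "P_poly u C lam ?X * ?D = translate (-1) ?f"
    by (rule P_poly_eq[OF assms]) simp
  moreover from this have "?D \<noteq> 0" using f0 tr0 by (metis mult_zero_right)
  ultimately show ?thesis by (metis mult_cancel_right)
qed

text \<open>What a submodule looks like from the side of \<open>\<bbbk>[t]\<close>: \<open>y\<close> provides multiplication by \<open>t\<close>
  and so an ideal, \<open>h\<close> the Euler operator (its other terms are multiples of the argument), and
  \<open>x\<close> the operator \<open>\<partial> Q(\<theta> - 1)\<close>, with the shift by \<open>-1\<close> moved into the polynomial.\<close>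

lemma left_submodule_weyl_closed:
  fixes u :: "'k::alg_closed_field poly"
  assumes lam: "lam \<in># proots (u + [:C:])"
    and N: "left_submodule (smith_algebra u) (exp_act u p C lam (proots (u + [:C:]) - {#lam#})) N"
  defines "Q \<equiv> poly_of_roots (proots (u + [:C:]) - {#lam#})"
  shows "0 \<in> N" "\<And>v w. v \<in> N \<Longrightarrow> w \<in> N \<Longrightarrow> v + w \<in> N"
    and "\<And>f v. v \<in> N \<Longrightarrow> f * v \<in> N"
    and "\<And>v. v \<in> N \<Longrightarrow> [:0, 1:] * pderiv v \<in> N"
    and "\<And>v. v \<in> N \<Longrightarrow> exp_op p D_gen (h_act p lam (translate (-1) Q) v) \<in> N"
proof -
  let ?X = "proots (u + [:C:]) - {#lam#}"
  define c where "c = lead_coeff (u + [:C:])"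
  have c: "c \<noteq> 0" unfolding c_def leading_coeff_0_iff using lam by auto
  show zero: "0 \<in> N" and add: "\<And>v w. v \<in> N \<Longrightarrow> w \<in> N \<Longrightarrow> v + w \<in> N"
    using N unfolding left_submodule_def by blast+
  have act: "free_act (exp_op p) (subst (phi_gen u C lam ?X) a) v \<in> N" if "v \<in> N" for a v
  proof -
    have "smith_class u a \<in> carrier (smith_algebra u)"
      by (simp add: smith_algebra_def smith_class_def carrier_presented_algebra)
    then have "exp_act u p C lam ?X (smith_class u a) v \<in> N"
      using N that unfolding left_submodule_def by blast
    then show ?thesis by (simp add: exp_act_class[OF lam])
  qed
  have smult: "smult a v \<in> N" if "v \<in> N" for a v
    using act[OF that, of "cst a"] by simp
  have t: "[:0, 1:] * v \<in> N" if "v \<in> N" for v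
  proof -
    have "smult c ([:0, 1:] * v) \<in> N"
      using act[OF that, of "gen Y_gen"]
      by (simp add: P_poly_full[OF lam] c_def peval_pCons free_act_mult)
    from smult[OF this, of "inverse c"] show ?thesis using c by simp
  qed
  show mult: "f * v \<in> N" if "v \<in> N" for f v
  proof (induction f)
    case (pCons a f)
    have "pCons a f * v = smult a v + [:0, 1:] * (f * v)" by simp
    then show ?case using add[OF smult[OF that] t[OF pCons(2)]] by simp
  qed (simp add: zero)
  show "[:0, 1:] * pderiv v \<in> N" if "v \<in> N" for v
  proof -
    have "free_act (exp_op p) (theta lam) v \<in> N" using act[OF that, of "gen H_gen"] by simp
    from add[OF this mult[OF that, of "- ([:0, 1:] * pderiv p + [:lam + 1:])"]]
    have "free_act (exp_op p) (theta lam) v + - ([:0, 1:] * pderiv p + [:lam + 1:]) * v \<in> N" .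
    moreover have "free_act (exp_op p) (theta lam) v + - ([:0, 1:] * pderiv p + [:lam + 1:]) * v =
        [:0, 1:] * pderiv v"
    proof -
      have "[:lam + 1:] * v = smult (lam + 1) v" by simp
      then show ?thesis
        unfolding free_act_theta
        by (simp only: distrib_left distrib_right minus_mult_left[symmetric])
          (simp only: mult_ac, simp only: minus_add_distrib add_ac, simp)
    qed
    ultimately show ?thesis by (simp only:)
  qed
  show "exp_op p D_gen (h_act p lam (translate (-1) Q) v) \<in> N" if "v \<in> N" for v
  proof -
    have "theta lam + cst (-1) = theta lam - 1" by (simp add: cst_minus)
    then show ?thesis
      using act[OF that, of "gen X_gen"]
      by (simp add: free_act_mult h_act_def peval_translate Q_def del: exp_op.simps)
  qed
qed

lemma simple_exp_module:
  fixes u p :: "'k::{alg_closed_field, field_char_0} poly"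
  assumes lam: "lam \<in># proots (u + [:C:])"
    and no_mu: "\<not> (\<exists>\<mu> \<in># proots (u + [:C:]) - {#lam#}. \<exists>n::int. n \<ge> 1 \<and> \<mu> - lam = of_int n)"
  shows "simple_left_module (smith_algebra u) (exp_act u p C lam (proots (u + [:C:]) - {#lam#}))"
proof -
  let ?X = "proots (u + [:C:]) - {#lam#}"
  have "N = UNIV" if N: "left_submodule (smith_algebra u) (exp_act u p C lam ?X) N" and "N \<noteq> {0}" for N
  proof -
    note cl = left_submodule_weyl_closed[OF lam N]
    obtain q0 where "q0 \<in> N \<and> q0 \<noteq> 0" using \<open>N \<noteq> {0}\<close> cl(1) by blast
    from ex_has_least_nat[of "\<lambda>q. q \<in> N \<and> q \<noteq> 0", OF this, of degree]
    obtain q where q: "q \<in> N" "q \<noteq> 0"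
      and min: "\<And>r. r \<in> N \<Longrightarrow> r \<noteq> 0 \<Longrightarrow> degree q \<le> degree r"
      by blast
    define d where "d = degree q"
    have coeff: "coeff ([:0, 1:] * pderiv q + [:- of_nat d:] * q) i = (of_nat i - of_nat d) * coeff q i" for i
      by (cases i) (simp_all add: coeff_pderiv algebra_simps)
    \<comment> \<open>The operator \<open>t d/dt - d\<close> kills the leading term of \<open>q\<close> and preserves \<open>N\<close>, so by
      minimality it kills \<open>q\<close>; in characteristic zero only \<open>t\<^sup>d\<close> survives.\<close>
    have "[:0, 1:] * pderiv q + [:- of_nat d:] * q = 0"
    proof (rule ccontr)
      let ?r = "[:0, 1:] * pderiv q + [:- of_nat d:] * q"
      assume nz: "?r \<noteq> 0"
      have "degree ?r < degree q"
      proof (rule degree_less_if_less_eqI)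
        show "degree ?r \<le> degree q" by (rule degree_le) (simp only: coeff, simp add: coeff_eq_0)
        show "coeff ?r (degree q) = 0" by (simp only: coeff, simp add: d_def)
      qed (rule nz)
      then show False using min[OF cl(2)[OF cl(4)[OF q(1)] cl(3)[OF q(1)]] nz] by simp
    qed
    then have "(of_nat i - of_nat d) * coeff q i = 0" for i
      unfolding coeff[symmetric] by simp
    then have zero: "i = d \<or> coeff q i = 0" for i by simp
    have "coeff q i = coeff (smult (lead_coeff q) (monom 1 d)) i" for i
      using zero[of i] by (auto simp: d_def)
    then have mon: "q = smult (lead_coeff q) (monom 1 d)" by (rule poly_eqI)
    from mon[symmetric] have "[:inverse (lead_coeff q):] * q =
        smult (inverse (lead_coeff q)) (smult (lead_coeff q) (monom 1 d))"
      by (simp only: mult_pCons_left mult_zero_left pCons_0_0 add_0_right)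
    then have "monom 1 d = [:inverse (lead_coeff q):] * q" using q(2) by simp
    then have td: "monom 1 d \<in> N" using cl(3)[OF q(1)] by (simp only:)
    have "d = 0"
    proof (rule ccontr)
      assume "d \<noteq> 0"
      then obtain e where e: "d = Suc e" by (cases d) auto
      let ?Q = "poly_of_roots ?X"
      let ?w = "h_act p (lam + of_nat d) (translate (-1) ?Q) 1"
      \<comment> \<open>The cofactor of \<open>t\<^sup>d\<^sup>-\<^sup>1\<close> in \<open>x t\<^sup>d\<close>; its constant term is \<open>d Q(\<lambda> + d)\<close>.\<close>
      define s where "s = smult (of_nat d) ?w + [:0, 1:] * (pderiv ?w + ?w * pderiv p)"
      have D: "exp_op p D_gen (monom 1 d * w) =
          monom 1 e * (smult (of_nat d) w + [:0, 1:] * (pderiv w + w * pderiv p))" for w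
      proof -
        have t: "monom (1::'k) d = monom 1 e * [:0, 1:]" by (simp add: e monom_Suc mult.commute)
        have dt: "pderiv (monom (1::'k) d) = monom 1 e * [:of_nat d:]"
          by (simp add: e pderiv_monom smult_monom)
        have "exp_op p D_gen (monom 1 d * w) =
            monom 1 d * (pderiv w + w * pderiv p) + pderiv (monom 1 d) * w"
          by (simp add: pderiv_mult algebra_simps)
        also have "\<dots> = monom 1 e * ([:0, 1:] * (pderiv w + w * pderiv p))
            + monom 1 e * ([:of_nat d:] * w)"
          unfolding dt unfolding t by (simp only: mult.assoc)
        also have "\<dots> = monom 1 e * (smult (of_nat d) w + [:0, 1:] * (pderiv w + w * pderiv p))"
          by (simp add: distrib_left)
        finally show ?thesis .
      qed
      have s: "monom 1 e * s \<in> N"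
        using cl(5)[OF td] h_act_monom_mult[of p lam "translate (-1) ?Q" d 1]
        unfolding s_def D[symmetric] by (simp only: mult_1_right)
      have "poly s 0 = of_nat d * poly ?Q (lam + of_nat d)"
        by (simp add: s_def poly_h_act_0 translate_def poly_pcompose)
      moreover have "poly ?Q (lam + of_nat d) \<noteq> 0"
      proof
        assume "poly ?Q (lam + of_nat d) = 0"
        then have "lam + of_nat d \<in># ?X" by (simp only: poly_poly_of_roots_eq_0_iff)
        moreover have "(lam + of_nat d) - lam = of_int (int d)" by simp
        moreover have "int d \<ge> 1" using e by simp
        ultimately show False using no_mu by blast
      qed
      ultimately have s0: "poly s 0 \<noteq> 0" using \<open>d \<noteq> 0\<close> by simp
      obtain a r where ar: "s = pCons a r" by (rule pCons_cases)
      \<comment> \<open>Apart from its constant term, \<open>s\<close> contributes multiples of \<open>t\<^sup>d\<close>, which lie in \<open>N\<close>.\<close>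
      have "monom 1 e * s + (- r) * monom 1 d = smult a (monom 1 e)"
        by (simp add: ar e monom_Suc mult.commute)
      then have "smult a (monom 1 e) \<in> N" using cl(2)[OF s cl(3)[OF td, of "- r"]] by (simp only:)
      moreover have "smult a (monom 1 e) \<noteq> 0" "degree (smult a (monom 1 e)) = e"
        using s0 ar by (simp_all add: degree_monom_eq)
      ultimately show False using min[of "smult a (monom 1 e)"] e d_def by simp
    qed
    then have "1 \<in> N" using td by (simp add: monom_0 one_pCons)
    then show "N = UNIV" using cl(3)[of 1] by auto
  qed
  moreover have "\<exists>v :: 'k poly. v \<noteq> 0" by (rule exI[of _ 1]) simp
  ultimately show ?thesis
    unfolding simple_left_module_def using left_module_exp_act[OF lam, of ?X p] by auto
qed

theorem theorem2p5:
  fixes g u p :: "'k::{alg_closed_field, field_char_0} poly"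
    and C lam :: 'k
    and X :: "'k multiset"
  assumes "g \<noteq> 0"
    and "g = translate (-1) u - u"
    and "degree p \<ge> 1"
    and "lam \<in># proots (u + [:C:])"
    and "X \<subseteq># proots (u + [:C:]) - {#lam#}"
  shows "free_module_of_rank (exp_h_scale u p C lam X) (degree p) \<and>
         (\<not> (\<exists>\<mu> \<in># proots (u + [:C:]) - {#lam#}. \<exists>n::int. n \<ge> 1 \<and> \<mu> - lam = of_int n) \<longrightarrow>
          simple_left_module (smith_algebra u)
            (exp_act u p C lam (proots (u + [:C:]) - {#lam#})))"
  using free_module_h_act[OF assms(3)] simple_exp_module[OF assms(4)]
  unfolding exp_h_scale_eq[OF assms(4,5)] by blast

end
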